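(* Let $X$ be a locally compact space with a sock $\{p_\alpha\}_{\alpha\in\mathbb{I}}$ such that, in addition, $p_\alpha p_\beta=p_\alpha$ for every $\alpha\leq\beta$ in $\mathbb{I}$. Let $g\colon X\to M$ be a continuous map into a metrizable space $M$. Then there is $\alpha_0\in\mathbb{I}$ such that $g=g p_{\alpha_0}$.
   Context: All spaces are assumed to be Tychonoff (completely regular Hausdorff). Juxtaposition of maps denotes composition. $\mathscr{C}(X,Y)$ denotes the space of continuous functions from $X$ to $Y$ with the compact-open topology. $\mathscr{K}(X)$ is the poset of compact subsets of $X$ ordered by inclusion. A directed set $(\mathbb{I},\leq)$ is long if every countable subset $C\subseteq\mathbb{I}$ has an upper bound in $\mathbb{I}$. A poset is an $\omega$-cpo if every non-decreasing sequence $\{\alpha_k\}_{k<\omega}$ in it has a supremum. A sock (i.e. an $\aleph_0$-sock) on $X$ is a family $\{p_\alpha\}_{\alpha\in\mathbb{I}}$ of retracts on $X$ (continuous maps $p_\alpha\colon X\to X$ with $p_\alpha p_\alpha=p_\alpha$), indexed by a long $\omega$-cpo $(\mathbb{I},\leq)$, such that: (S1) $K_\alpha:=p_\alpha(X)$ is compact for every $\alpha\in\mathbb{I}$; (S2) $p_\beta p_\alpha=p_\alpha$ (equivalently, $K_\alpha\subseteq K_\beta$) whenever $\alpha\leq\beta$; (S3) $\{K_\alpha\}_{\alpha\in\mathbb{I}}$ is cofinal in $\mathscr{K}(X)$; (S4) for every non-decreasing sequence $\{\alpha_k\}_{k<\omega}$ in $\mathbb{I}$ with $\gamma=\sup_{k<\omega}\alpha_k$,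 one has $\lim p_{\alpha_k}=p_\gamma$ in $\mathscr{C}(X,K_\gamma)$. *)

theory Defs
  imports "HOL-Analysis.Analysis"
begin

definition tychonoff_space :: "'a topology \<Rightarrow> bool" where
  "tychonoff_space X \<longleftrightarrow> completely_regular_space X \<and> Hausdorff_space X"

text \<open>
  Points of the function space are continuous maps that take the value \<^term>\<open>undefined\<close> outside
  \<^term>\<open>topspace X\<close>, so that maps agreeing on \<^term>\<open>topspace X\<close> are the same point.
  The subbasic set for \<open>K = {}\<close> is the whole carrier.
\<close>

definition continuous_maps :: "'a topology \<Rightarrow> 'b topology \<Rightarrow> ('a \<Rightarrow> 'b) set" where
  "continuous_maps X Y = {f \<in> extensional (topspace X). continuous_map X Y f}"

definition compact_open_topology :: "'a topology \<Rightarrow> 'b topology \<Rightarrow> ('a \<Rightarrow> 'b) topology" where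
  "compact_open_topology X Y =
     topology_generated_by
       {{f \<in> continuous_maps X Y. f ` K \<subseteq> U} | K U. compactin X K \<and> openin Y U}"

lemma topspace_compact_open_topology [simp]:
  "topspace (compact_open_topology X Y) = continuous_maps X Y"
proof -
  have "continuous_maps X Y \<in>
      {{f \<in> continuous_maps X Y. f ` K \<subseteq> U} | K U. compactin X K \<and> openin Y U}"
    by (rule CollectI, rule exI[of _ "{}"], rule exI[of _ "{}"]) auto
  then show ?thesis
    unfolding compact_open_topology_def topology_generated_by_topspace by blast
qed

text \<open>
  A poset is a carrier \<open>I\<close> with a relation \<open>r\<close>, where \<open>(\<alpha>, \<beta>) \<in> r\<close> reads \<open>\<alpha> \<le> \<beta>\<close>.
\<close>

definition is_sup_in :: "'i set \<Rightarrow> 'i rel \<Rightarrow> 'i set \<Rightarrow> 'i \<Rightarrow> bool" where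
  "is_sup_in I r A \<gamma> \<longleftrightarrow>
     \<gamma> \<in> I \<and> (\<forall>\<alpha>\<in>A. (\<alpha>, \<gamma>) \<in> r) \<and> (\<forall>\<delta>\<in>I. (\<forall>\<alpha>\<in>A. (\<alpha>, \<delta>) \<in> r) \<longrightarrow> (\<gamma>, \<delta>) \<in> r)"

definition nondecreasing_seq :: "'i set \<Rightarrow> 'i rel \<Rightarrow> (nat \<Rightarrow> 'i) \<Rightarrow> bool" where
  "nondecreasing_seq I r a \<longleftrightarrow> range a \<subseteq> I \<and> (\<forall>m n. m \<le> n \<longrightarrow> (a m, a n) \<in> r)"

definition directed_set :: "'i set \<Rightarrow> 'i rel \<Rightarrow> bool" where
  "directed_set I r \<longleftrightarrow>
     preorder_on I r \<and> I \<noteq> {} \<and> (\<forall>\<alpha>\<in>I. \<forall>\<beta>\<in>I. \<exists>\<gamma>\<in>I. (\<alpha>, \<gamma>) \<in> r \<and> (\<beta>, \<gamma>) \<in> r)"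

definition long_directed_set :: "'i set \<Rightarrow> 'i rel \<Rightarrow> bool" where
  "long_directed_set I r \<longleftrightarrow>
     directed_set I r \<and>
     (\<forall>C. C \<subseteq> I \<and> countable C \<longrightarrow> (\<exists>\<beta>\<in>I. \<forall>\<alpha>\<in>C. (\<alpha>, \<beta>) \<in> r))"

definition omega_cpo :: "'i set \<Rightarrow> 'i rel \<Rightarrow> bool" where
  "omega_cpo I r \<longleftrightarrow>
     partial_order_on I r \<and>
     (\<forall>a. nondecreasing_seq I r a \<longrightarrow> (\<exists>\<gamma>. is_sup_in I r (range a) \<gamma>))"

text \<open>
  Self-maps of \<open>X\<close> are only meaningful on \<^term>\<open>topspace X\<close>, so identities between them are
  stated pointwise there.
\<close>

definition retract_on :: "'a topology \<Rightarrow> ('a \<Rightarrow> 'a) \<Rightarrow> bool" where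
  "retract_on X p \<longleftrightarrow> continuous_map X X p \<and> (\<forall>x\<in>topspace X. p (p x) = p x)"

definition sock :: "'a topology \<Rightarrow> 'i set \<Rightarrow> 'i rel \<Rightarrow> ('i \<Rightarrow> 'a \<Rightarrow> 'a) \<Rightarrow> bool" where
  "sock X I r p \<longleftrightarrow>
     long_directed_set I r \<and> omega_cpo I r \<and>
     (\<forall>\<alpha>\<in>I. retract_on X (p \<alpha>)) \<and>
     (\<forall>\<alpha>\<in>I. compactin X (p \<alpha> ` topspace X)) \<and>
     (\<forall>\<alpha>\<in>I. \<forall>\<beta>\<in>I. (\<alpha>, \<beta>) \<in> r \<longrightarrow> (\<forall>x\<in>topspace X. p \<beta> (p \<alpha> x) = p \<alpha> x)) \<and>
     (\<forall>K. compactin X K \<longrightarrow> (\<exists>\<alpha>\<in>I. K \<subseteq> p \<alpha> ` topspace X)) \<and>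
     (\<forall>a \<gamma>. nondecreasing_seq I r a \<and> is_sup_in I r (range a) \<gamma> \<longrightarrow>
        limitin (compact_open_topology X (subtopology X (p \<gamma> ` topspace X)))
          (\<lambda>k. restrict (p (a k)) (topspace X)) (restrict (p \<gamma>) (topspace X)) sequentially)"

end

theory Submission
  imports Defs
begin

text \<open>
  The idea is that \<open>g \<circ> p \<alpha>\<close> converges uniformly on all of \<open>X\<close> along increasing sequences of
  indices, and that a long index set turns uniform approximation into equality.

  Let \<open>d\<close> be a metric for \<open>M\<close>. If \<open>\<gamma>\<close> is the supremum of an increasing sequence \<open>a\<close>, then
  convergence in the compact-open topology makes \<open>g \<circ> p (a k)\<close> converge uniformly on the compact
  set \<open>p \<gamma> ` topspace X\<close>. The hypothesis \<open>p \<alpha> \<circ> p \<beta> = p \<alpha>\<close> for \<open>\<alpha> \<le> \<beta>\<close> says that \<open>p (a k)\<close>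
  factors through \<open>p \<gamma>\<close>, so the convergence is uniform on the whole, possibly noncompact, space
  (\<open>sock_uniform_limit\<close>). Hence for each \<open>\<epsilon> > 0\<close> some index \<open>\<alpha>\<close> satisfies
  \<open>d (g (p \<beta> x)) (g (p \<alpha> x)) < \<epsilon>\<close> for all \<open>\<beta> \<ge> \<alpha>\<close> and all \<open>x\<close>: otherwise one could climb forever,
  each step moving \<open>g \<circ> p \<alpha>\<close> by at least \<open>\<epsilon>\<close>, and the resulting increasing sequence would violate
  uniform convergence (\<open>sock_uniform_stabilization\<close>).

  Take such indices for \<open>\<epsilon> = 1/(n + 1)\<close>, \<open>n \<in> \<nat>\<close>, and an upper bound \<open>\<alpha>\<^sub>0\<close> of them. Beyond \<open>\<alpha>\<^sub>0\<close>
  the maps \<open>g \<circ> p \<beta>\<close> do not change at all. Since every point \<open>x\<close> is fixed by \<open>p \<beta>\<close> for some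
  \<open>\<beta> \<ge> \<alpha>\<^sub>0\<close>, it follows that \<open>g x = g (p \<beta> x) = g (p \<alpha>\<^sub>0 x)\<close>.
\<close>

section \<open>Compact-open convergence is uniform on compact sets\<close>

lemma limitin_compact_open_eventually_image_subset:
  assumes lim: "limitin (compact_open_topology X Y) f l F"
    and "compactin X K" "openin Y U" "l ` K \<subseteq> U"
  shows "\<forall>\<^sub>F i in F. f i ` K \<subseteq> U"
proof -
  let ?V = "{h \<in> continuous_maps X Y. h ` K \<subseteq> U}"
  have "openin (compact_open_topology X Y) ?V"
    unfolding compact_open_topology_def
    using assms by (intro topology_generated_by_Basis) blast
  moreover have "l \<in> ?V"
    using lim assms(4) by (simp add: limitin_def)
  ultimately have "\<forall>\<^sub>F i in F. f i \<in> ?V"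
    using lim unfolding limitin_def by blast
  then show ?thesis
    by (rule eventually_mono) simp
qed

text \<open>
  The set \<open>K\<close> is covered by finitely many compact pieces, on each of which \<open>h \<circ> l\<close> stays within
  \<open>\<epsilon>/3\<close> of the value at a centre; this reduces the claim to finitely many subbasic neighbourhoods
  of \<open>l\<close>.
\<close>

lemma (in Metric_space) limitin_compact_open_uniform_on_compact:
  assumes lim: "limitin (compact_open_topology X Y) f l F"
    and h: "continuous_map Y mtopology h"
    and K: "compactin X K" and \<epsilon>: "\<epsilon> > 0"
  shows "\<forall>\<^sub>F i in F. \<forall>x\<in>K. d (h (f i x)) (h (l x)) < \<epsilon>"
proof -
  have l: "continuous_map X Y l"
    using lim by (simp add: limitin_def continuous_maps_def)
  then have hl: "continuous_map X mtopology (h \<circ> l)"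
    using h by (rule continuous_map_compose)
  have KX: "K \<subseteq> topspace X"
    using K by (rule compactin_subset_topspace)
  have hlM: "h (l x) \<in> M" if "x \<in> topspace X" for x
    using continuous_map_funspace[OF hl] that by auto
  \<comment> \<open>The open sets \<open>W x\<close> provide the finite cover, and their closed versions \<open>C x\<close> are compact, as a
    subbasic neighbourhood requires. The radius of \<open>U x\<close> exceeds \<open>\<epsilon>/3\<close> so that \<open>l\<close> maps \<open>C x\<close> into
    \<open>U x\<close>, and is small enough that \<open>\<epsilon>/2 + \<epsilon>/3 < \<epsilon>\<close>.\<close>
  define W where "W x = {y \<in> topspace X. (h \<circ> l) y \<in> mball (h (l x)) (\<epsilon>/3)}" for x
  define C where "C x = {y \<in> topspace X. (h \<circ> l) y \<in> mcball (h (l x)) (\<epsilon>/3)} \<inter> K" for x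
  define U where "U x = {z \<in> topspace Y. h z \<in> mball (h (l x)) (\<epsilon>/2)}" for x
  have "openin X (W x)" for x
    unfolding W_def by (rule openin_continuous_map_preimage[OF hl]) simp
  moreover have "x \<in> W x" if "x \<in> K" for x
    using that KX hlM \<epsilon> by (auto simp: W_def)
  ultimately obtain T where T: "finite T" "T \<subseteq> K" "K \<subseteq> (\<Union>x\<in>T. W x)"
    using K unfolding compactin_def
    by (smt (verit) UN_iff finite_subset_image imageE subsetI)
  have near: "\<forall>\<^sub>F i in F. f i ` C x \<subseteq> U x" if "x \<in> T" for x
  proof (rule limitin_compact_open_eventually_image_subset[OF lim])
    have "closedin X {y \<in> topspace X. (h \<circ> l) y \<in> mcball (h (l x)) (\<epsilon>/3)}"
      by (rule closedin_continuous_map_preimage[OF hl]) simp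
    then show "compactin X (C x)"
      unfolding C_def using K by (rule closed_Int_compactin)
    show "openin Y (U x)"
      unfolding U_def by (rule openin_continuous_map_preimage[OF h]) simp
    show "l ` C x \<subseteq> U x"
      using continuous_map_funspace[OF l] \<epsilon> by (auto simp: C_def U_def)
  qed
  have "\<forall>\<^sub>F i in F. \<forall>x\<in>T. f i ` C x \<subseteq> U x"
    using T(1) near by (simp add: eventually_ball_finite)
  then show ?thesis
  proof (rule eventually_mono, intro ballI)
    fix i y assume i: "\<forall>x\<in>T. f i ` C x \<subseteq> U x" and y: "y \<in> K"
    obtain x where x: "x \<in> T" "y \<in> W x"
      using T(3) y by blast
    then have "y \<in> C x"
      using y by (auto simp: W_def C_def)
    then have "f i y \<in> U x"
      using i x(1) by blast
    then have 1: "h (f i y) \<in> M" "h (l x) \<in> M" "d (h (l x)) (h (f i y)) < \<epsilon>/2"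
      by (auto simp: U_def)
    have 2: "h (l y) \<in> M" "d (h (l x)) (h (l y)) < \<epsilon>/3"
      using x(2) by (auto simp: W_def)
    show "d (h (f i y)) (h (l y)) < \<epsilon>"
      using triangle[OF 1(1,2) 2(1)] 1(3) 2(2) \<epsilon> commute[of "h (f i y)" "h (l x)"] by linarith
  qed
qed

section \<open>Maps from a sock into a metric space\<close>

lemma sockD:
  assumes "sock X I r p"
  shows "\<alpha> \<in> I \<Longrightarrow> continuous_map X X (p \<alpha>)"
    and "\<alpha> \<in> I \<Longrightarrow> x \<in> topspace X \<Longrightarrow> p \<alpha> x \<in> topspace X"
    and "\<alpha> \<in> I \<Longrightarrow> x \<in> topspace X \<Longrightarrow> p \<alpha> (p \<alpha> x) = p \<alpha> x"
    and "\<alpha> \<in> I \<Longrightarrow> compactin X (p \<alpha> ` topspace X)"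
    and "\<alpha> \<in> I \<Longrightarrow> \<beta> \<in> I \<Longrightarrow> (\<alpha>, \<beta>) \<in> r \<Longrightarrow> x \<in> topspace X \<Longrightarrow> p \<beta> (p \<alpha> x) = p \<alpha> x"
    and "compactin X K \<Longrightarrow> \<exists>\<alpha>\<in>I. K \<subseteq> p \<alpha> ` topspace X"
    and "nondecreasing_seq I r a \<Longrightarrow> is_sup_in I r (range a) \<gamma> \<Longrightarrow>
        limitin (compact_open_topology X (subtopology X (p \<gamma> ` topspace X)))
          (\<lambda>k. restrict (p (a k)) (topspace X)) (restrict (p \<gamma>) (topspace X)) sequentially"
    and "refl_on I r" and "trans r"
    and "nondecreasing_seq I r a \<Longrightarrow> \<exists>\<gamma>. is_sup_in I r (range a) \<gamma>"
    and "C \<subseteq> I \<Longrightarrow> countable C \<Longrightarrow> \<exists>\<beta>\<in>I. \<forall>\<alpha>\<in>C. (\<alpha>, \<beta>) \<in> r"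
proof -
  show "\<alpha> \<in> I \<Longrightarrow> continuous_map X X (p \<alpha>)"
    using assms by (simp add: sock_def retract_on_def)
  then show "\<alpha> \<in> I \<Longrightarrow> x \<in> topspace X \<Longrightarrow> p \<alpha> x \<in> topspace X"
    using continuous_map_funspace by fastforce
qed (use assms in \<open>simp_all add: sock_def retract_on_def long_directed_set_def omega_cpo_def
    partial_order_on_def preorder_on_def\<close>)

text \<open>
  Uniform convergence on the compact set \<open>p \<gamma> ` topspace X\<close> transfers to the whole space because
  \<open>p (a k) x = p (a k) (p \<gamma> x)\<close>.
\<close>

lemma (in Metric_space) sock_uniform_limit:
  assumes sock: "sock X I r p"
    and comm: "\<And>\<alpha> \<beta> x. \<alpha> \<in> I \<Longrightarrow> \<beta> \<in> I \<Longrightarrow> (\<alpha>, \<beta>) \<in> r \<Longrightarrow> x \<in> topspace X \<Longrightarrow> p \<alpha> (p \<beta> x) = p \<alpha> x"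
    and g: "continuous_map X mtopology g"
    and a: "nondecreasing_seq I r a" and \<gamma>: "is_sup_in I r (range a) \<gamma>" and \<epsilon>: "\<epsilon> > 0"
  shows "\<forall>\<^sub>F k in sequentially. \<forall>x\<in>topspace X. d (g (p (a k) x)) (g (p \<gamma> x)) < \<epsilon>"
proof -
  let ?K = "p \<gamma> ` topspace X"
  have \<gamma>I: "\<gamma> \<in> I" and aI: "a k \<in> I" and a\<gamma>: "(a k, \<gamma>) \<in> r" for k
    using \<gamma> a by (auto simp: is_sup_in_def nondecreasing_seq_def)
  have "\<forall>\<^sub>F k in sequentially. \<forall>y\<in>?K.
      d (g (restrict (p (a k)) (topspace X) y)) (g (restrict (p \<gamma>) (topspace X) y)) < \<epsilon>"
    by (rule limitin_compact_open_uniform_on_compact[OF sockD(7)[OF sock a \<gamma>]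
          continuous_map_from_subtopology[OF g] sockD(4)[OF sock \<gamma>I] \<epsilon>])
  then show ?thesis
    by (rule eventually_mono)
      (simp add: sockD(2,3)[OF sock \<gamma>I] comm[OF aI \<gamma>I a\<gamma>])
qed

text \<open>
  If no index worked, a sequence climbing by steps that each move \<open>g \<circ> p \<alpha>\<close> by at least \<open>\<epsilon>\<close> could
  not converge uniformly.
\<close>

lemma (in Metric_space) sock_uniform_stabilization:
  assumes sock: "sock X I r p"
    and comm: "\<And>\<alpha> \<beta> x. \<alpha> \<in> I \<Longrightarrow> \<beta> \<in> I \<Longrightarrow> (\<alpha>, \<beta>) \<in> r \<Longrightarrow> x \<in> topspace X \<Longrightarrow> p \<alpha> (p \<beta> x) = p \<alpha> x"
    and g: "continuous_map X mtopology g" and \<epsilon>: "\<epsilon> > 0"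
  shows "\<exists>\<alpha>\<in>I. \<forall>\<beta>\<in>I. (\<alpha>, \<beta>) \<in> r \<longrightarrow> (\<forall>x\<in>topspace X. d (g (p \<beta> x)) (g (p \<alpha> x)) < \<epsilon>)"
proof (rule ccontr)
  assume "\<not> ?thesis"
  then have step: "\<exists>\<beta>\<in>I. (\<alpha>, \<beta>) \<in> r \<and> (\<exists>x\<in>topspace X. d (g (p \<beta> x)) (g (p \<alpha> x)) \<ge> \<epsilon>)"
    if "\<alpha> \<in> I" for \<alpha>
    using that by (meson not_le)
  obtain \<alpha> where "\<alpha> \<in> I"
    using sockD(6)[OF sock compactin_empty] by blast
  obtain a where aI: "\<And>n::nat. a n \<in> I"
    and a: "\<And>n. (a n, a (Suc n)) \<in> r \<and>
      (\<exists>x\<in>topspace X. d (g (p (a (Suc n)) x)) (g (p (a n) x)) \<ge> \<epsilon>)"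
    using dependent_nat_choice[where P = "\<lambda>_ \<alpha>. \<alpha> \<in> I" and Q = "\<lambda>_ \<alpha> \<beta>. (\<alpha>, \<beta>) \<in> r \<and>
        (\<exists>x\<in>topspace X. d (g (p \<beta> x)) (g (p \<alpha> x)) \<ge> \<epsilon>)"] \<open>\<alpha> \<in> I\<close> step
    by (metis (no_types, lifting))
  have "(a m, a n) \<in> r" if "m \<le> n" for m n
    using that
  proof (induction rule: dec_induct)
    case base
    show ?case
      using sockD(8)[OF sock] aI by (simp add: refl_on_def)
  next
    case (step n)
    then show ?case
      using a transD[OF sockD(9)[OF sock]] by blast
  qed
  then have mono: "nondecreasing_seq I r a"
    using aI by (auto simp: nondecreasing_seq_def)
  then obtain \<gamma> where \<gamma>: "is_sup_in I r (range a) \<gamma>"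
    using sockD(10)[OF sock] by blast
  have "\<epsilon>/2 > 0"
    using \<epsilon> by simp
  from sock_uniform_limit[OF sock comm g mono \<gamma> this]
  obtain N where N: "\<And>k x. k \<ge> N \<Longrightarrow> x \<in> topspace X \<Longrightarrow> d (g (p (a k) x)) (g (p \<gamma> x)) < \<epsilon>/2"
    unfolding eventually_sequentially by blast
  obtain x where x: "x \<in> topspace X" "d (g (p (a (Suc N)) x)) (g (p (a N) x)) \<ge> \<epsilon>"
    using a by blast
  have M: "g (p \<beta> x) \<in> M" if "\<beta> \<in> I" for \<beta>
    using continuous_map_funspace[OF g] sockD(2)[OF sock that x(1)] by auto
  have "\<gamma> \<in> I"
    using \<gamma> by (simp add: is_sup_in_def)
  then have "d (g (p (a (Suc N)) x)) (g (p (a N) x)) < \<epsilon>/2 + \<epsilon>/2"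
    using triangle'[OF M M M, of "a (Suc N)" \<gamma> "a N"] N[of "Suc N"] N[of N] x(1) aI
      commute[of "g (p (a N) x)" "g (p \<gamma> x)"]
    by (smt (verit) le_SucI order_refl)
  with x(2) show False
    by simp
qed

theorem theorem2p10:
  fixes X :: "'a topology" and M :: "'b topology"
    and I :: "'i set" and r :: "'i rel"
    and p :: "'i \<Rightarrow> 'a \<Rightarrow> 'a" and g :: "'a \<Rightarrow> 'b"
  assumes "tychonoff_space X" and "locally_compact_space X"
    and "sock X I r p"
    and "\<And>\<alpha> \<beta> x. \<alpha> \<in> I \<Longrightarrow> \<beta> \<in> I \<Longrightarrow> (\<alpha>, \<beta>) \<in> r \<Longrightarrow> x \<in> topspace X \<Longrightarrow> p \<alpha> (p \<beta> x) = p \<alpha> x"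
    and "metrizable_space M" and "continuous_map X M g"
  shows "\<exists>\<alpha>\<^sub>0\<in>I. \<forall>x\<in>topspace X. g x = g (p \<alpha>\<^sub>0 x)"
proof -
  note sock = assms(3)
  obtain A d where "Metric_space A d" and M: "M = Metric_space.mtopology A d"
    using assms(5) unfolding metrizable_space_def by blast
  interpret Metric_space A d by fact
  have g: "continuous_map X mtopology g"
    using assms(6) M by simp
  have "\<exists>\<alpha>\<in>I. \<forall>\<beta>\<in>I. (\<alpha>, \<beta>) \<in> r \<longrightarrow> (\<forall>x\<in>topspace X. d (g (p \<beta> x)) (g (p \<alpha> x)) < inverse (Suc n))"
    for n :: nat
    by (rule sock_uniform_stabilization[OF sock assms(4) g]) auto
  then obtain a where aI: "\<And>n::nat. a n \<in> I"
    and a: "\<And>n \<beta> x. \<beta> \<in> I \<Longrightarrow> (a n, \<beta>) \<in> r \<Longrightarrow> x \<in> topspace X \<Longrightarrow>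
      d (g (p \<beta> x)) (g (p (a n) x)) < inverse (Suc n)"
    by metis
  obtain \<alpha>\<^sub>0 where \<alpha>0: "\<alpha>\<^sub>0 \<in> I" "\<And>n. (a n, \<alpha>\<^sub>0) \<in> r"
    using sockD(11)[OF sock, of "range a"] aI by auto
  have "g x = g (p \<alpha>\<^sub>0 x)" if x: "x \<in> topspace X" for x
  proof -
    obtain \<delta> where \<delta>: "\<delta> \<in> I" "x \<in> p \<delta> ` topspace X"
      using sockD(6)[OF sock, of "{x}"] x by auto
    obtain \<beta> where \<beta>: "\<beta> \<in> I" "(\<alpha>\<^sub>0, \<beta>) \<in> r" "(\<delta>, \<beta>) \<in> r"
      using sockD(11)[OF sock, of "{\<alpha>\<^sub>0, \<delta>}"] \<alpha>0(1) \<delta>(1) by auto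
    have fixed: "p \<beta> x = x"
      using \<delta>(2) sockD(5)[OF sock \<delta>(1) \<beta>(1,3)] by auto
    have A: "g (p \<eta> x) \<in> A" if "\<eta> \<in> I" for \<eta>
      using continuous_map_funspace[OF g] sockD(2)[OF sock that x] by auto
    have "d (g (p \<beta> x)) (g (p \<alpha>\<^sub>0 x)) \<le> e" if "e > 0" for e
    proof -
      have "e/2 > 0"
        using that by simp
      then obtain n where n: "inverse (real (Suc n)) < e/2"
        using reals_Archimedean by blast
      have "(a n, \<beta>) \<in> r"
        using transD[OF sockD(9)[OF sock] \<alpha>0(2) \<beta>(2)] .
      then have "d (g (p \<beta> x)) (g (p (a n) x)) < e/2"
        using a[OF \<beta>(1) _ x, of n] n by simp
      moreover have "d (g (p \<alpha>\<^sub>0 x)) (g (p (a n) x)) < e/2"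
        using a[OF \<alpha>0 x, of n] n by simp
      ultimately show ?thesis
        using triangle'[OF A A A, of \<beta> "a n" "\<alpha>\<^sub>0"] \<beta>(1) aI \<alpha>0(1)
          commute[of "g (p \<alpha>\<^sub>0 x)" "g (p (a n) x)"]
        by (smt (verit) field_sum_of_halves)
    qed
    then have "d (g (p \<beta> x)) (g (p \<alpha>\<^sub>0 x)) \<le> 0"
      by (rule field_le_epsilon[where y = 0, simplified])
    then show ?thesis
      using zero[OF A A, of \<beta> "\<alpha>\<^sub>0"] nonneg[of "g (p \<beta> x)" "g (p \<alpha>\<^sub>0 x)"] \<beta>(1) \<alpha>0(1) fixed
      by (metis order_antisym)
  qed
  then show ?thesis
    using \<alpha>0(1) by blast
qed

end
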